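(* Let $G$ be a group and let $H\le G$ be a finite-index subgroup. Then $H$ is commensurably coHopfian if and only if $G$ is commensurably coHopfian.
   Context: A group $\Gamma$ is commensurably coHopfian if no finite-index subgroup of $\Gamma$ is isomorphic to an infinite-index subgroup of $\Gamma$. *)

theory Defs
  imports "HOL-Algebra.Coset"
begin

(* Right and left cosets are equinumerous, so the choice of side is immaterial. The index is not taken
   to be card (rcosets H), since card is 0 on infinite sets. *)
definition finite_index_subgroup :: "'a set \<Rightarrow> ('a, 'b) monoid_scheme \<Rightarrow> bool"
  where "finite_index_subgroup H G \<longleftrightarrow> subgroup H G \<and> finite (rcosets\<^bsub>G\<^esub> H)"

definition infinite_index_subgroup :: "'a set \<Rightarrow> ('a, 'b) monoid_scheme \<Rightarrow> bool"
  where "infinite_index_subgroup H G \<longleftrightarrow> subgroup H G \<and> infinite (rcosets\<^bsub>G\<^esub> H)"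

definition commensurably_coHopfian :: "('a, 'b) monoid_scheme \<Rightarrow> bool"
  where "commensurably_coHopfian G \<longleftrightarrow>
    \<not> (\<exists>K L. finite_index_subgroup K G \<and> infinite_index_subgroup L G \<and>
            G\<lparr>carrier := K\<rparr> \<cong> G\<lparr>carrier := L\<rparr>)"

end

theory Submission
  imports Defs
begin

text \<open>
  An isomorphism \<open>\<phi>\<close> from a finite-index subgroup \<open>K\<close> of \<open>G\<close> to an infinite-index subgroup \<open>L\<close>
  restricts to one between such subgroups of \<open>H\<close>: \<open>K \<inter> H \<inter> \<phi>\<^sup>-\<^sup>1(H)\<close> has finite index
  in \<open>H\<close>, while its image under \<open>\<phi>\<close> lies in \<open>L\<close> and hence has infinite index in \<open>G\<close>, so also
  in \<open>H\<close>. Conversely, passing from \<open>H\<close> to \<open>G\<close> changes neither finiteness nor infiniteness of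
  the index of a subgroup of \<open>H\<close>.
\<close>

lemma rcosets_eq_image: "rcosets\<^bsub>G\<^esub> H = (\<lambda>a. H #>\<^bsub>G\<^esub> a) ` carrier G"
  unfolding RCOSETS_def by blast

text \<open>A coset is built from the multiplication alone, so cosets taken inside a subgroup are
  literally cosets of the ambient group. This makes indices over different carriers
  comparable.\<close>

lemma r_coset_carrier_update [simp]: "A #>\<^bsub>G\<lparr>carrier := B\<rparr>\<^esub> x = A #>\<^bsub>G\<^esub> x"
  by (simp add: r_coset_def)

lemma finite_index_subgroup_imp_subgroup:
  "finite_index_subgroup H G \<Longrightarrow> subgroup H G"
  by (simp add: finite_index_subgroup_def)

text \<open>Each coset of \<open>A\<close> in the whole group is a coset of \<open>A\<close> in
  \<open>B\<close> translated by a representative of a coset of \<open>B\<close>, so finitely many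
  pairs of cosets account for all of them.\<close>

lemma (in group) finite_index_subgroup_trans:
  assumes A: "finite_index_subgroup A (G\<lparr>carrier := B\<rparr>)" and B: "finite_index_subgroup B G"
  shows "finite_index_subgroup A G"
proof -
  have subB: "subgroup B G" using B by (rule finite_index_subgroup_imp_subgroup)
  have subA: "subgroup A G"
    using incl_subgroup[OF subB finite_index_subgroup_imp_subgroup[OF A]] .
  \<comment> \<open>One representative \<open>r D\<close> is fixed per coset \<open>D\<close>.
    Writing x = b r(Bx) with b in \<open>B\<close> then gives Ax = (Ab) r(Bx), which depends only on
    the pair (Ab, Bx).\<close>
  have "\<forall>D\<in>rcosets B. \<exists>g\<in>carrier G. B #> g = D" by (auto simp: rcosets_eq_image)
  then obtain r where r: "\<And>D. D \<in> rcosets B \<Longrightarrow> r D \<in> carrier G \<and> B #> r D = D"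
    by metis
  have "A #> x \<in> (\<lambda>(C, D). C #> r D) ` ((rcosets\<^bsub>G\<lparr>carrier := B\<rparr>\<^esub> A) \<times> (rcosets B))"
    if x: "x \<in> carrier G" for x
  proof -
    have D: "B #> x \<in> rcosets B" using x by (auto simp: rcosets_eq_image)
    have "x \<in> B #> r (B #> x)" using r[OF D] rcos_self[OF x subB] by simp
    then obtain b where b: "b \<in> B" "x = b \<otimes> r (B #> x)" by (auto simp: r_coset_def)
    have "(A #> b) #> r (B #> x) = A #> x"
      using coset_mult_assoc[of A b "r (B #> x)"] b r[OF D] subgroup.subset[OF subA]
        subgroup.subset[OF subB] by auto
    moreover have "A #> b \<in> rcosets\<^bsub>G\<lparr>carrier := B\<rparr>\<^esub> A"
      using b by (auto simp: rcosets_eq_image)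
    ultimately show ?thesis using D by force
  qed
  then have "rcosets A \<subseteq> (\<lambda>(C, D). C #> r D) ` ((rcosets\<^bsub>G\<lparr>carrier := B\<rparr>\<^esub> A) \<times> (rcosets B))"
    by (auto simp: rcosets_eq_image[of G A])
  then have "finite (rcosets A)"
    by (rule finite_subset) (use A B in \<open>simp add: finite_index_subgroup_def\<close>)
  with subA show ?thesis by (simp add: finite_index_subgroup_def)
qed

text \<open>Left multiplication by \<open>B\<close> sends the coset Ax to BAx = Bx, hence maps the
  cosets of \<open>A\<close> onto those of \<open>B\<close>.\<close>

lemma (in group) finite_index_subgroup_mono:
  assumes A: "finite_index_subgroup A G" and B: "subgroup B G" and AB: "A \<subseteq> B"
  shows "finite_index_subgroup B G"
proof -
  have subA: "subgroup A G" using A by (rule finite_index_subgroup_imp_subgroup)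
  have "b \<in> B <#> A" if "b \<in> B" for b
    using set_mult_def[of G B A] that subgroup.one_closed[OF subA]
      r_one[OF subgroup.mem_carrier[OF B that]] by force
  then have BA: "B <#> A = B"
    using AB by (auto simp: set_mult_def subgroup.m_closed[OF B])
  have "B #> x = B <#> (A #> x)" if "x \<in> carrier G" for x
    using setmult_rcos_assoc[OF subgroup.subset[OF B] subgroup.subset[OF subA] that] BA by simp
  then have "rcosets B = (\<lambda>C. B <#> C) ` (rcosets A)"
    by (auto simp: rcosets_eq_image image_image)
  then show ?thesis using A B by (simp add: finite_index_subgroup_def)
qed

text \<open>The cosets of the preimage of \<open>H\<close> are preimages of cosets of
  \<open>H\<close>. Besides the isomorphism in the main argument, this also handles intersections,
  via inclusion maps.\<close>

lemma finite_index_subgroup_vimage: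
  assumes "group_hom K G \<phi>" and H: "finite_index_subgroup H G"
  shows "finite_index_subgroup {x \<in> carrier K. \<phi> x \<in> H} K"
proof -
  interpret group_hom K G \<phi> by fact
  have subH: "subgroup H G" using H by (rule finite_index_subgroup_imp_subgroup)
  let ?P = "{x \<in> carrier K. \<phi> x \<in> H}"
  \<comment> \<open>Inside \<open>group_hom\<close> the prefix \<open>G\<close> denotes the source,
    here \<open>K\<close>, and the prefix \<open>H\<close> denotes the target, here
    \<open>G\<close>.\<close>
  have subP: "subgroup ?P K"
    by (rule G.subgroupI)
      (use subH in \<open>auto simp: subgroup.m_closed subgroup.m_inv_closed subgroup.one_closed
        intro: exI[of _ "\<one>\<^bsub>K\<^esub>"]\<close>)
  have coset: "?P #>\<^bsub>K\<^esub> x = {y \<in> carrier K. \<phi> y \<in> H #>\<^bsub>G\<^esub> \<phi> x}" if x: "x \<in> carrier K" for x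
  proof (rule subset_antisym; rule subsetI)
    fix y assume "y \<in> ?P #>\<^bsub>K\<^esub> x"
    then show "y \<in> {y \<in> carrier K. \<phi> y \<in> H #>\<^bsub>G\<^esub> \<phi> x}" using x by (auto simp: r_coset_def)
  next
    fix y assume "y \<in> {y \<in> carrier K. \<phi> y \<in> H #>\<^bsub>G\<^esub> \<phi> x}"
    then obtain h where y: "y \<in> carrier K" and h: "h \<in> H" "\<phi> y = h \<otimes>\<^bsub>G\<^esub> \<phi> x"
      by (auto simp: r_coset_def)
    have "\<phi> (y \<otimes>\<^bsub>K\<^esub> inv\<^bsub>K\<^esub> x) = h"
      using x y h subgroup.mem_carrier[OF subH] by (simp add: H.m_assoc)
    then have "y \<otimes>\<^bsub>K\<^esub> inv\<^bsub>K\<^esub> x \<in> ?P" using x y h by simp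
    moreover have "y = (y \<otimes>\<^bsub>K\<^esub> inv\<^bsub>K\<^esub> x) \<otimes>\<^bsub>K\<^esub> x" using x y by (simp add: G.m_assoc)
    ultimately show "y \<in> ?P #>\<^bsub>K\<^esub> x" unfolding r_coset_def by blast
  qed
  \<comment> \<open>Only an inclusion: a coset of \<open>H\<close> that misses the image of
    \<open>\<phi>\<close> has empty preimage.\<close>
  have "rcosets\<^bsub>K\<^esub> ?P \<subseteq> (\<lambda>C. {y \<in> carrier K. \<phi> y \<in> C}) ` (rcosets\<^bsub>G\<^esub> H)"
    by (auto simp: rcosets_eq_image coset)
  then have "finite (rcosets\<^bsub>K\<^esub> ?P)"
    by (rule finite_subset) (use H in \<open>simp add: finite_index_subgroup_def\<close>)
  with subP show ?thesis by (simp add: finite_index_subgroup_def)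
qed

text \<open>The intersection is the preimage of \<open>A\<close> under the inclusion of
  \<open>B\<close> into the group.\<close>

lemma (in group) finite_index_subgroup_Int:
  assumes "finite_index_subgroup A G" and B: "subgroup B G"
  shows "finite_index_subgroup (B \<inter> A) (G\<lparr>carrier := B\<rparr>)"
proof -
  from finite_index_subgroup_vimage[OF canonical_inj_is_hom[OF B] assms(1)]
  show ?thesis by (simp add: Int_def)
qed

lemma (in group) commensurably_coHopfian_finite_index_subgroup:
  assumes H: "finite_index_subgroup H G" and "commensurably_coHopfian G"
  shows "commensurably_coHopfian (G\<lparr>carrier := H\<rparr>)"
  unfolding commensurably_coHopfian_def
proof (intro notI, elim exE conjE)
  fix K L
  assume K: "finite_index_subgroup K (G\<lparr>carrier := H\<rparr>)"
    and L: "infinite_index_subgroup L (G\<lparr>carrier := H\<rparr>)"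
    and iso: "G\<lparr>carrier := H, carrier := K\<rparr> \<cong> G\<lparr>carrier := H, carrier := L\<rparr>"
  have subH: "subgroup H G" using H by (rule finite_index_subgroup_imp_subgroup)
  have subL: "subgroup L (G\<lparr>carrier := H\<rparr>)" using L by (simp add: infinite_index_subgroup_def)
  \<comment> \<open>If \<open>L\<close> had finite index in \<open>G\<close>, then its intersection
    with \<open>H\<close>, which is \<open>L\<close> itself, would have finite index in
    \<open>H\<close>.\<close>
  have "H \<inter> L = L" using subgroup.subset[OF subL] by auto
  then have "\<not> finite_index_subgroup L G"
    using finite_index_subgroup_Int[OF _ subH, of L] L
    by (auto simp: finite_index_subgroup_def infinite_index_subgroup_def)
  then have "infinite_index_subgroup L G"
    using incl_subgroup[OF subH subL]
    by (simp add: finite_index_subgroup_def infinite_index_subgroup_def)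
  moreover have "finite_index_subgroup K G" using finite_index_subgroup_trans[OF K H] .
  ultimately show False
    using assms(2) iso by (auto simp: commensurably_coHopfian_def)
qed

lemma (in group) commensurably_coHopfian_finite_index_overgroup:
  assumes H: "finite_index_subgroup H G" and "commensurably_coHopfian (G\<lparr>carrier := H\<rparr>)"
  shows "commensurably_coHopfian G"
  unfolding commensurably_coHopfian_def
proof (intro notI, elim exE conjE)
  fix K L
  assume K: "finite_index_subgroup K G" and L: "infinite_index_subgroup L G"
    and "G\<lparr>carrier := K\<rparr> \<cong> G\<lparr>carrier := L\<rparr>"
  then obtain \<phi> where iso: "\<phi> \<in> iso (G\<lparr>carrier := K\<rparr>) (G\<lparr>carrier := L\<rparr>)"
    by (auto simp: is_iso_def)
  have subH: "subgroup H G" and subK: "subgroup K G" and subL: "subgroup L G"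
    using H K L by (auto simp: finite_index_subgroup_def infinite_index_subgroup_def)
  have hom: "\<phi> \<in> hom (G\<lparr>carrier := K\<rparr>) (G\<lparr>carrier := L\<rparr>)" and bij: "bij_betw \<phi> K L"
    using iso by (auto simp: iso_def)
  have subHK: "subgroup (H \<inter> K) G" using subgroups_Inter_pair[OF subH subK] .
  define K' where "K' = {x \<in> H \<inter> K. \<phi> x \<in> H}"
  \<comment> \<open>The codomain is enlarged from \<open>L\<close> to \<open>G\<close>, because the
    preimage is taken of \<open>H\<close>, which need not lie in \<open>L\<close>.\<close>
  have homHK: "group_hom (G\<lparr>carrier := H \<inter> K\<rparr>) G \<phi>"
    unfolding group_hom_def group_hom_axioms_def
  proof (intro conjI subgroup_imp_group[OF subHK] is_group)
    show "\<phi> \<in> hom (G\<lparr>carrier := H \<inter> K\<rparr>) G"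
      using hom subgroup.subset[OF subL] by (auto simp: hom_def Pi_iff)
  qed
  have HK: "finite_index_subgroup (H \<inter> K) (G\<lparr>carrier := H\<rparr>)"
    using finite_index_subgroup_Int[OF K subH] .
  have "finite_index_subgroup K' (G\<lparr>carrier := H \<inter> K\<rparr>)"
    using finite_index_subgroup_vimage[OF homHK H] by (simp add: K'_def)
  \<comment> \<open>Transitivity is applied inside the group \<open>H\<close>, along the chain
    \<open>K'\<close>, \<open>H \<inter> K\<close>, \<open>H\<close>.\<close>
  then have K': "finite_index_subgroup K' (G\<lparr>carrier := H\<rparr>)"
    using group.finite_index_subgroup_trans[OF subgroup_imp_group[OF subH] _ HK] by simp
  have subK': "subgroup K' (G\<lparr>carrier := H \<inter> K\<rparr>)"
    using \<open>finite_index_subgroup K' (G\<lparr>carrier := H \<inter> K\<rparr>)\<close>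
    by (rule finite_index_subgroup_imp_subgroup)
  define L' where "L' = \<phi> ` K'"
  have subL': "subgroup L' G"
    unfolding L'_def using group_hom.subgroup_img_is_subgroup[OF homHK subK'] .
  have "L' \<subseteq> H" and "L' \<subseteq> L"
    using bij unfolding L'_def K'_def bij_betw_def by blast+
  \<comment> \<open>Finite index of \<open>L'\<close> in \<open>H\<close> would pass to
    \<open>G\<close> by transitivity and then up to the larger subgroup \<open>L\<close>.\<close>
  have "\<not> finite_index_subgroup L' (G\<lparr>carrier := H\<rparr>)"
  proof
    assume "finite_index_subgroup L' (G\<lparr>carrier := H\<rparr>)"
    then have "finite_index_subgroup L' G" using H by (rule finite_index_subgroup_trans)
    then have "finite_index_subgroup L G" using subL \<open>L' \<subseteq> L\<close> by (rule finite_index_subgroup_mono)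
    with L show False by (simp add: finite_index_subgroup_def infinite_index_subgroup_def)
  qed
  then have "infinite_index_subgroup L' (G\<lparr>carrier := H\<rparr>)"
    using subgroup_incl[OF subL' subH \<open>L' \<subseteq> H\<close>]
    by (simp add: finite_index_subgroup_def infinite_index_subgroup_def)
  moreover have "\<phi> \<in> iso (G\<lparr>carrier := K'\<rparr>) (G\<lparr>carrier := L'\<rparr>)"
  proof -
    have "bij_betw \<phi> K' L'"
      unfolding L'_def by (rule bij_betw_subset[OF bij]) (auto simp: K'_def)
    moreover have "\<phi> \<in> hom (G\<lparr>carrier := K'\<rparr>) (G\<lparr>carrier := L'\<rparr>)"
      using hom subgroup.m_closed[OF subK'] by (auto simp: hom_def L'_def K'_def)
    ultimately show ?thesis by (simp add: iso_def)
  qed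
  ultimately show False
    using assms(2) K' by (auto simp: commensurably_coHopfian_def is_iso_def)
qed

theorem lemma1p4:
  fixes G :: "('a, 'b) monoid_scheme" and H :: "'a set"
  assumes "group G" and "finite_index_subgroup H G"
  shows "commensurably_coHopfian (G\<lparr>carrier := H\<rparr>) \<longleftrightarrow> commensurably_coHopfian G"
  using group.commensurably_coHopfian_finite_index_subgroup[OF assms]
    group.commensurably_coHopfian_finite_index_overgroup[OF assms] by blast

end
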